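(* Let $M$ be a square $\{0,1\}$-matrix with exactly $k$ diagonal entries equal to $0$ and exactly $\ell$ diagonal entries equal to $1$, and let $D$ be a minimal $M$-obstruction. If $D$ contains neither a pair of false twins nor a pair of true twins, then $|V(D)|\le (k+1)(\ell+1)$.
   Context: Digraphs are finite, without loops and multiple arcs. A strong clique: set $C$ with both $(x,y),(y,x)$ arcs for all distinct $x,y\in C$; an independent set: set with no arcs between any two of its vertices. For disjoint $S,S'$, $S$ is completely adjacent (resp. completely non-adjacent) to $S'$ if $(x,x')$ is an arc for all (resp. no) $x\in S,x'\in S'$. An $M$-partition of $D$ ($M$ of size $k+\ell$) is a partition of $V(D)$ into possibly empty parts $V_1,\dots,V_{k+\ell}$ with $V_i$ independent if $M(i,i)=0$, a strong clique if $M(i,i)=1$, and for $i\ne j$, $V_i$ completely non-adjacent to $V_j$ if $M(i,j)=0$ and completely adjacent to $V_j$ if $M(i,j)=1$. A minimal $M$-obstruction is a digraph with no $M$-partition such that $D-v$ has an $M$-partition for every vertex $v$. For distinct vertices $u,v,w$, $w$ distinguishes $u,v$ if exactly one of $u,v$ is an in-neighbour of $w$ or exactly one is an out-neighbour of $w$; distinct $u,v$ are twins if no vertex distinguishes them; true twins if moreover both $(u,v),(v,u)$ are arcs, false twins if neither is an arc. *)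

theory Defs
  imports
    "Graph_Theory.Digraph"
    "Jordan_Normal_Form.Matrix"
    "HOL-Library.Disjoint_Sets"
begin

text \<open>
  The locale \<^locale>\<open>digraph\<close> describes finite digraphs without loops and multiple arcs
  (possibly with no vertices), and \<open>u \<rightarrow>\<^bsub>D\<^esub> v\<close> says that \<open>(u, v)\<close> is an arc of \<open>D\<close>.
\<close>

definition strong_clique :: "('a,'b) pre_digraph \<Rightarrow> 'a set \<Rightarrow> bool" where
  "strong_clique D C \<longleftrightarrow> C \<subseteq> verts D \<and>
     (\<forall>x\<in>C. \<forall>y\<in>C. x \<noteq> y \<longrightarrow> (x \<rightarrow>\<^bsub>D\<^esub> y) \<and> (y \<rightarrow>\<^bsub>D\<^esub> x))"

definition independent_set :: "('a,'b) pre_digraph \<Rightarrow> 'a set \<Rightarrow> bool" where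
  "independent_set D S \<longleftrightarrow> S \<subseteq> verts D \<and> (\<forall>x\<in>S. \<forall>y\<in>S. \<not> (x \<rightarrow>\<^bsub>D\<^esub> y))"

text \<open>Both of the following relations are directed: only arcs from \<open>S\<close> to \<open>S'\<close> matter.\<close>

definition completely_adjacent :: "('a,'b) pre_digraph \<Rightarrow> 'a set \<Rightarrow> 'a set \<Rightarrow> bool" where
  "completely_adjacent D S S' \<longleftrightarrow> (\<forall>x\<in>S. \<forall>x'\<in>S'. x \<rightarrow>\<^bsub>D\<^esub> x')"

definition completely_nonadjacent :: "('a,'b) pre_digraph \<Rightarrow> 'a set \<Rightarrow> 'a set \<Rightarrow> bool" where
  "completely_nonadjacent D S S' \<longleftrightarrow> (\<forall>x\<in>S. \<forall>x'\<in>S'. \<not> (x \<rightarrow>\<^bsub>D\<^esub> x'))"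

text \<open>
  The parts are an indexed family, since they may be empty; indices run from \<open>0\<close> to
  \<open>dim_row M - 1\<close>.
\<close>

definition M_partition ::
  "nat mat \<Rightarrow> ('a,'b) pre_digraph \<Rightarrow> (nat \<Rightarrow> 'a set) \<Rightarrow> bool" where
  "M_partition M D V \<longleftrightarrow>
     (\<Union>i<dim_row M. V i) = verts D \<and>
     disjoint_family_on V {..<dim_row M} \<and>
     (\<forall>i<dim_row M.
        (M $$ (i, i) = 0 \<longrightarrow> independent_set D (V i)) \<and>
        (M $$ (i, i) = 1 \<longrightarrow> strong_clique D (V i))) \<and>
     (\<forall>i<dim_row M. \<forall>j<dim_row M. i \<noteq> j \<longrightarrow>
        (M $$ (i, j) = 0 \<longrightarrow> completely_nonadjacent D (V i) (V j)) \<and>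
        (M $$ (i, j) = 1 \<longrightarrow> completely_adjacent D (V i) (V j)))"

definition minimal_M_obstruction :: "nat mat \<Rightarrow> ('a,'b) pre_digraph \<Rightarrow> bool" where
  "minimal_M_obstruction M D \<longleftrightarrow>
     digraph D \<and>
     \<not> (\<exists>V. M_partition M D V) \<and>
     (\<forall>v\<in>verts D. \<exists>V. M_partition M (pre_digraph.del_vert D v) V)"

definition distinguishes :: "('a,'b) pre_digraph \<Rightarrow> 'a \<Rightarrow> 'a \<Rightarrow> 'a \<Rightarrow> bool" where
  "distinguishes D w u v \<longleftrightarrow>
     w \<noteq> u \<and> w \<noteq> v \<and>
     ((u \<rightarrow>\<^bsub>D\<^esub> w) \<noteq> (v \<rightarrow>\<^bsub>D\<^esub> w) \<or> (w \<rightarrow>\<^bsub>D\<^esub> u) \<noteq> (w \<rightarrow>\<^bsub>D\<^esub> v))"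

definition twins :: "('a,'b) pre_digraph \<Rightarrow> 'a \<Rightarrow> 'a \<Rightarrow> bool" where
  "twins D u v \<longleftrightarrow> u \<in> verts D \<and> v \<in> verts D \<and> u \<noteq> v \<and>
     \<not> (\<exists>w\<in>verts D. distinguishes D w u v)"

definition true_twins :: "('a,'b) pre_digraph \<Rightarrow> 'a \<Rightarrow> 'a \<Rightarrow> bool" where
  "true_twins D u v \<longleftrightarrow> twins D u v \<and> (u \<rightarrow>\<^bsub>D\<^esub> v) \<and> (v \<rightarrow>\<^bsub>D\<^esub> u)"

definition false_twins :: "('a,'b) pre_digraph \<Rightarrow> 'a \<Rightarrow> 'a \<Rightarrow> bool" where
  "false_twins D u v \<longleftrightarrow> twins D u v \<and> \<not> (u \<rightarrow>\<^bsub>D\<^esub> v) \<and> \<not> (v \<rightarrow>\<^bsub>D\<^esub> u)"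

end

theory Submission
  imports Defs
begin

text \<open>
  Two vertices in the same part of an \<open>M\<close>-partition of \<open>D - v\<close> are twins in \<open>D - v\<close>; as \<open>D\<close> is
  twin-free, \<open>v\<close> is their only distinguisher, and we say that \<open>v\<close> labels the pair. By Bondy's theorem
  the labels of the pairs of one type (both arcs, or no arc) inside a nonempty vertex set are fewer than
  the vertices of that set. This settles the case \<open>k = 0\<close> or \<open>l = 0\<close>. In general some vertex labels at
  most one pair: if labelled pairs of different types never share a vertex, Bondy's theorem yields a
  vertex labelling none; if two of them meet, the vertices involved form a small, explicitly known
  configuration in which such a vertex is visible. Hence \<open>card (verts D) \<le> k + l + 2\<close>, which is at most
  \<open>(k + 1) * (l + 1)\<close> for positive \<open>k\<close> and \<open>l\<close>.
\<close>

section \<open>Bondy's theorem for rows and columns\<close>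

text \<open>Bondy's argument: forgetting the columns of \<open>L\<close> one by one loses at least one row each time.\<close>

lemma card_labels_less:
  fixes r :: "'x \<Rightarrow> 'c \<Rightarrow> 'd"
  assumes "finite L" "finite X" "X \<noteq> {}"
    and "\<And>v. v \<in> L \<Longrightarrow> \<exists>x\<in>X. \<exists>y\<in>X. r x v \<noteq> r y v \<and> (\<forall>w. w \<noteq> v \<longrightarrow> r x w = r y w)"
  shows "card L < card X"
proof -
  \<comment> \<open>\<open>?R L x\<close> is row \<open>x\<close> with the columns in
    \<open>L\<close> masked. Rows differing only in column \<open>v\<close> are still distinct
    before \<open>v\<close> is masked and coincide afterwards.\<close>
  let ?R = "\<lambda>L x w. if w \<in> L then undefined else r x w"
  have "card L + card (?R L ` X) \<le> card X"
    using assms(1,4)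
  proof (induction L rule: finite_induct)
    case empty
    then show ?case using card_image_le[OF assms(2)] by simp
  next
    case (insert v L)
    obtain x y where xy: "x \<in> X" "y \<in> X" "r x v \<noteq> r y v" "\<And>w. w \<noteq> v \<Longrightarrow> r x w = r y w"
      using insert.prems[of v] by blast
    define g where "g f w = (if w = v then undefined else f w)" for f :: "'c \<Rightarrow> 'd" and w
    have img: "?R (insert v L) ` X = g ` (?R L ` X)"
      unfolding image_image by (intro image_cong refl ext) (auto simp: g_def)
    have "?R L x \<noteq> ?R L y"
      using xy(3) insert.hyps(2) by (auto dest: fun_cong[of _ _ v])
    moreover have "g (?R L x) = g (?R L y)"
      by (rule ext) (simp add: g_def xy(4))
    ultimately have "\<not> inj_on g (?R L ` X)"
      using xy(1,2) by (meson image_eqI inj_onD)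
    then have "card (?R (insert v L) ` X) < card (?R L ` X)"
      unfolding img using assms(2) card_image_le[of "?R L ` X" g] eq_card_imp_inj_on[of "?R L ` X" g]
      by fastforce
    moreover have "card L + card (?R L ` X) \<le> card X"
      using insert.IH insert.prems by blast
    ultimately show ?case using insert.hyps by simp
  qed
  \<comment> \<open>At least one masked row remains, which makes the bound strict.\<close>
  moreover have "card (?R L ` X) > 0"
    using assms(2,3) by (simp add: card_gt_0_iff)
  ultimately show ?thesis by linarith
qed

section \<open>Labelled pairs in a twin-free digraph\<close>

locale twin_free =
  fixes V :: "'a set" and E :: "'a \<Rightarrow> 'a \<Rightarrow> bool"
  assumes finV: "finite V"
    and no_twins: "\<lbrakk>x \<in> V; y \<in> V; x \<noteq> y; E x y = b; E y x = b\<rbrakk> \<Longrightarrow>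
      \<exists>w\<in>V. w \<noteq> x \<and> w \<noteq> y \<and> (E x w, E w x) \<noteq> (E y w, E w y)"
begin

definition adj :: "'a \<Rightarrow> 'a \<Rightarrow> bool \<times> bool" where
  "adj x y = (E x y, E y x)"

text \<open>\<open>v\<close> labels the pair \<open>x\<close>, \<open>y\<close>; the type
  \<open>b\<close> is \<open>True\<close> for both arcs and \<open>False\<close> for none. Pairs
  joined by a single arc have no type, and the locale allows them to be twins.\<close>

definition near :: "bool \<Rightarrow> 'a \<Rightarrow> 'a \<Rightarrow> 'a \<Rightarrow> bool" where
  "near b v x y \<longleftrightarrow> v \<in> V \<and> x \<in> V \<and> y \<in> V \<and> x \<noteq> y \<and> v \<noteq> x \<and> v \<noteq> y \<and> adj x y = (b, b) \<and>
     adj x v \<noteq> adj y v \<and> (\<forall>w\<in>V. w \<noteq> x \<and> w \<noteq> y \<and> w \<noteq> v \<longrightarrow> adj x w = adj y w)"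

lemma adj_diag_comm: "adj x y = (b, b) \<longleftrightarrow> adj y x = (b, b)"
  by (auto simp: adj_def)

lemma adj_diag_sym: "adj x y = (b, b) \<Longrightarrow> adj y x = (b, b)"
  by (auto simp: adj_def)

lemma adj_right_iff: "adj w x = adj w y \<longleftrightarrow> adj x w = adj y w"
  by (auto simp: adj_def)

lemma near_sym: "near b v x y \<Longrightarrow> near b v y x"
  using adj_diag_sym[of x y b] by (auto simp: near_def)

lemma nearD:
  assumes "near b v x y"
  shows "v \<in> V" "x \<in> V" "y \<in> V" "x \<noteq> y" "v \<noteq> x" "v \<noteq> y" "adj x y = (b, b)" "adj y x = (b, b)"
    "adj x v \<noteq> adj y v"
    "\<And>w. \<lbrakk>w \<in> V; w \<noteq> x; w \<noteq> y; w \<noteq> v\<rbrakk> \<Longrightarrow> adj x w = adj y w"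
  using assms adj_diag_sym[of x y b] unfolding near_def by auto

lemma twin_freeD:
  assumes "x \<in> V" "y \<in> V" "x \<noteq> y" "adj x y = (b, b)"
  shows "\<exists>w\<in>V. w \<noteq> x \<and> w \<noteq> y \<and> adj x w \<noteq> adj y w"
  using no_twins[of x y b] assms by (simp add: adj_def)

lemma card_near_labels_less:
  assumes "X \<subseteq> V" "X \<noteq> {}" "L \<subseteq> V"
    and L: "\<And>v. v \<in> L \<Longrightarrow> \<exists>x\<in>X. \<exists>y\<in>X. near b v x y"
  shows "card L < card X"
proof (rule card_labels_less)
  \<comment> \<open>With \<open>(b, b)\<close> on the diagonal, a pair of type \<open>b\<close> has equal rows off its distinguishers.\<close>
  let ?r = "\<lambda>x w. if w = x then (b, b) else if w \<in> V then adj x w else (b, b)"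
  fix v assume "v \<in> L"
  then obtain x y where xy: "x \<in> X" "y \<in> X" "near b v x y" using L by blast
  note n = nearD[OF xy(3)]
  have "?r x v \<noteq> ?r y v" "\<forall>w. w \<noteq> v \<longrightarrow> ?r x w = ?r y w"
    using n by auto
  then show "\<exists>x\<in>X. \<exists>y\<in>X. ?r x v \<noteq> ?r y v \<and> (\<forall>w. w \<noteq> v \<longrightarrow> ?r x w = ?r y w)"
    using xy by blast
next
  show "finite L" "finite X" by (rule finite_subset[OF assms(3) finV] finite_subset[OF assms(1) finV])+
qed (rule assms(2))

text \<open>Here \<open>{x, y, z}\<close> is a module with a single arc between \<open>y\<close> and \<open>z\<close>.\<close>

lemma single_arc_triple:
  assumes f: "near b z x y" and t: "near (\<not> b) y x z"
  shows "\<not> near c x p q"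
proof
  assume h: "near c x p q"
  note F = nearD[OF f] and T = nearD[OF t] and H = nearD[OF h]
  \<comment> \<open>\<open>z\<close> separates \<open>x\<close> from \<open>y\<close>, and
    \<open>y\<close> separates \<open>x\<close> from \<open>z\<close>. This excludes both diagonal
    values and leaves exactly one arc.\<close>
  have yz: "adj y z \<noteq> (c', c')" for c'
  proof -
    have "adj y z \<noteq> (\<not> b, \<not> b)" using F(9) T(7) by metis
    moreover have "adj z y \<noteq> (b, b)" using F(7) T(9) by metis
    ultimately show ?thesis using adj_diag_comm[of y z b] by (cases "c' = b") auto
  qed
  have zy: "adj z y \<noteq> (c', c')" for c' using yz[of c'] adj_diag_sym by metis
  have outside: "adj x r = adj y r \<and> adj x r = adj z r" if "r \<in> V" "r \<noteq> x" "r \<noteq> y" "r \<noteq> z" for r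
    using F(10) T(10) that by blast
  \<comment> \<open>If \<open>p\<close> is one end of the single arc, the other end
    \<open>p'\<close> does not separate \<open>p\<close> from \<open>q\<close>. But \<open>q\<close>
    lies outside the module, so it relates to both ends by \<open>(c, c)\<close>, and
    \<open>adj p p'\<close> would be diagonal.\<close>
  have aux: False if h: "near c x p q" and p: "p = y \<or> p = z" for p q
  proof -
    note H = nearD[OF h]
    have q: "q \<noteq> y" "q \<noteq> z" using H(4,7) yz[of c] zy[of c] p by auto
    define p' where "p' = (if p = y then z else y)"
    have p': "p' \<in> V" "p' \<noteq> p" "p' \<noteq> q" "p' \<noteq> x" using p q F(1-6) H(1-6) by (auto simp: p'_def)
    have "adj p p' = adj q p'" using H(10)[of p'] p' by blast
    moreover have "adj q p' = (c, c)"
    proof -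
      have "adj x q = adj p q" "adj x q = adj p' q"
        using outside[of q] q H(3,6) p by (auto simp: p'_def)
      then have "adj p' q = (c, c)" using H(7) by simp
      then show ?thesis by (rule adj_diag_comm[THEN iffD1])
    qed
    ultimately show False using yz zy p by (auto simp: p'_def split: if_splits)
  qed
  show False
  proof (cases "p = y \<or> p = z \<or> q = y \<or> q = z")
    case True
    then show ?thesis using aux[OF h] aux[OF near_sym[OF h]] by blast
  next
    \<comment> \<open>\<open>y\<close> does not separate \<open>p\<close> from \<open>q\<close>, and
      \<open>x\<close> agrees with \<open>y\<close> on both, so \<open>x\<close> cannot be their
      label.\<close>
    case False
    then have "adj x p = adj y p" "adj x q = adj y q" "adj p y = adj q y"
      using F(10)[of p] F(10)[of q] H(10)[of y] F(3,4) H(2-6) False by auto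
    then show ?thesis using H(9) by (metis adj_right_iff)
  qed
qed

text \<open>On \<open>x\<close>, \<open>y\<close>, \<open>z\<close> the pairs of type
  \<open>b\<close> form a path with middle vertex \<open>y\<close>. Since \<open>x\<close> and
  \<open>y\<close> agree outside \<open>z\<close>, a pair labelled by \<open>x\<close> must meet
  \<open>{y, z}\<close>; those containing \<open>y\<close> give the first alternative, the others
  the second.\<close>

lemma mixed_path_labels:
  assumes f: "near b z x y" and t: "near (\<not> b) w x z" and wy: "w \<noteq> y"
    and h: "near c x p q"
  shows "{p, q} = {y, w} \<and> adj w z = (b, b) \<and> adj x w = (\<not> b, \<not> b) \<or>
    (\<exists>r. {p, q} = {z, r} \<and> near b x z r \<and> adj x r = (b, b) \<and> r \<noteq> y \<and> r \<noteq> w)"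
proof -
  note F = nearD[OF f] and T = nearD[OF t] and H = nearD[OF h]
  have yz: "adj y z = (b, b)" using T(10)[of y] F wy by (metis adj_diag_comm)
  have wxy: "adj x w = adj y w" using F(10)[of w] T(1,5,6) wy by blast
  \<comment> \<open>\<open>w\<close> separates \<open>y\<close> from \<open>z\<close>, so
    \<open>q\<close> is not \<open>z\<close>. Then \<open>q\<close> turns out to separate
    \<open>x\<close> from \<open>z\<close>, which only \<open>w\<close> does.\<close>
  have Y: "q = w \<and> adj w z = (b, b) \<and> adj x w = (\<not> b, \<not> b)" if h: "near c x y q" for q
  proof -
    note H = nearD[OF h]
    have "q \<noteq> z" using T(9) H(10)[of w] wxy T wy by auto
    have qz: "adj q z = (b, b)" using H(10)[of z] yz F T \<open>q \<noteq> z\<close> by auto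
    have "adj x q \<noteq> (b, b)" using H(9) F(8) by (metis adj_diag_comm)
    then have "q = w" using T(10)[of q] qz H \<open>q \<noteq> z\<close> by (metis adj_diag_comm)
    moreover have "c = (\<not> b)" using \<open>adj x q \<noteq> (b, b)\<close> wxy H(7) \<open>q = w\<close> by auto
    ultimately show ?thesis using qz wxy H(7) by auto
  qed
  have Z: "near b x z q \<and> adj x q = (b, b) \<and> q \<noteq> y \<and> q \<noteq> w" if h: "near c x z q" and "q \<noteq> y" for q
  proof -
    note H = nearD[OF h]
    have yq: "adj y q = (b, b)" using H(10)[of y] yz F T that by (metis adj_diag_comm)
    have xq: "adj x q = (b, b)" using F(10)[of q] yq H that by auto
    have "q \<noteq> w"
    proof
      assume "q = w"
      \<comment> \<open>With \<open>q = w\<close>, the vertices \<open>x\<close> and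
        \<open>w\<close> would be twins of type \<open>b\<close>.\<close>
      have "adj x u = adj w u" if "u \<in> V" "u \<noteq> x" "u \<noteq> w" for u
      proof -
        consider "u = y" | "u = z" | "u \<noteq> y" "u \<noteq> z" by blast
        then show ?thesis
        proof cases
          case 1 then show ?thesis using yq F(7) \<open>q = w\<close> by (metis adj_diag_comm)
        next
          case 2
          have "adj z w \<noteq> (b, b)" using T(9) xq \<open>q = w\<close> by auto
          then have "c = (\<not> b)" using H(7) \<open>q = w\<close> by auto
          then show ?thesis using 2 H(8) T(7) \<open>q = w\<close> by auto
        next
          case 3 then show ?thesis using H(10)[of u] T(10)[of u] that \<open>q = w\<close> by auto
        qed
      qed
      then show False using twin_freeD[of x w b] xq T \<open>q = w\<close> by metis
    qed
    have "adj z q = (b, b)" using T(10)[of q] xq H \<open>q \<noteq> w\<close> by auto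
    then have "c = b" using H(7) by auto
    then show ?thesis using h xq \<open>q \<noteq> w\<close> that by auto
  qed
  have h': "near c x q p" using h by (rule near_sym)
  consider "p = y" | "q = y" | "p = z" "q \<noteq> y" | "q = z" "p \<noteq> y" | "p \<notin> {y,z}" "q \<notin> {y,z}" by blast
  then show ?thesis
  proof cases
    case 1 then show ?thesis using Y[of q] h by blast
  next
    case 2 then show ?thesis using Y[of p] h' by blast
  next
    case 3 then show ?thesis using Z[of q] h by blast
  next
    case 4 then show ?thesis using Z[of p] h' by blast
  next
    case 5
    then have "adj x p = adj y p" "adj x q = adj y q" "adj p y = adj q y"
      using F(10)[of p] F(10)[of q] H(10)[of y] F(3,4) H(2-6) 5 by auto
    then show ?thesis using H(9) by (metis adj_right_iff)
  qed
qed

text \<open>The vertex sought is \<open>x\<close> if it labels pairs of only one of its two possible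
  kinds, and otherwise the vertex \<open>r\<close> of the second kind.\<close>

lemma mixed_path_few_labels:
  assumes f: "near b z x y" and t: "near (\<not> b) w x z" and wy: "w \<noteq> y"
  shows "\<exists>u\<in>V. \<exists>P. \<forall>c p q. near c u p q \<longrightarrow> {p, q} = P"
proof -
  note F = nearD[OF f] and T = nearD[OF t]
  have yz: "adj y z = (b, b)" using T(10)[of y] F wy by (metis adj_diag_comm)
  have wxy: "adj x w = adj y w" using F(10)[of w] T(1,5,6) wy by blast
  \<comment> \<open>Two such vertices would be twins of type \<open>b\<close>: \<open>x\<close> and
    \<open>z\<close> see both as \<open>(b, b)\<close>, and any other vertex sees both as it sees
    \<open>z\<close>.\<close>
  have uniq: "r = r'" if r: "near b x z r" "adj x r = (b, b)" and r': "near b x z r'" "adj x r' = (b, b)" for r r'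
  proof (rule ccontr)
    assume ne: "r \<noteq> r'"
    note R = nearD[OF r(1)] and R' = nearD[OF r'(1)]
    have rr: "adj r r' = (b, b)" using R(10)[of r'] R' ne by auto
    have "adj r u = adj r' u" if "u \<in> V" "u \<noteq> r" "u \<noteq> r'" for u
    proof -
      consider "u = x" | "u = z" | "u \<noteq> x" "u \<noteq> z" by blast
      then show ?thesis
      proof cases
        case 1 then show ?thesis using r(2) r'(2) by (metis adj_diag_comm)
      next
        case 2 then show ?thesis using R R' by auto
      next
        case 3 then show ?thesis using R(10)[of u] R'(10)[of u] that by auto
      qed
    qed
    then show False using twin_freeD[of r r' b] rr R R' ne by metis
  qed
  show ?thesis
  proof (cases "\<exists>r. near b x z r \<and> adj x r = (b, b) \<and> r \<noteq> y \<and> r \<noteq> w")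
    case False
    then have "{p, q} = {y, w}" if "near c x p q" for c p q
      using mixed_path_labels[OF assms that] by blast
    then show ?thesis using F(2) by blast
  next
    case True
    then obtain r where r: "near b x z r" "adj x r = (b, b)" "r \<noteq> y" "r \<noteq> w" by blast
    note R = nearD[OF r(1)]
    \<comment> \<open>If both kinds of pairs occur, then \<open>z, x, w, y\<close> is a path (or the complement of one), \<open>r\<close> relates
      in the same way to all of it, and together they form a module; \<open>r\<close> labels nothing.\<close>
    show ?thesis
    proof (cases "\<exists>c. near c x y w")
      case False
      have "{p, q} = {z, r}" if "near c x p q" for c p q
        using mixed_path_labels[OF assms that]
      proof (elim disjE conjE exE)
        assume "{p, q} = {y, w}"
        then have "p = y \<and> q = w \<or> p = w \<and> q = y" by (simp add: doubleton_eq_iff)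
        then have "near c x y w" using that near_sym[of c x w y] by blast
        then show ?thesis using False by blast
      next
        fix r' assume "{p, q} = {z, r'}" "near b x z r'" "adj x r' = (b, b)"
        then show ?thesis using uniq[of r' r] r by blast
      qed
      then show ?thesis using F(2) by blast
    next
      case True
      then obtain c0 where h0: "near c0 x y w" by blast
      note H0 = nearD[OF h0]
      have "z \<noteq> w" using T(6) by blast
      have w: "adj w z = (b, b)" "adj x w = (\<not> b, \<not> b)"
        using mixed_path_labels[OF assms h0] \<open>z \<noteq> w\<close> F(4,5) wy by (auto simp: doubleton_eq_iff)
      have yr: "adj y r = (b, b)" using F(10)[of r] R r by auto
      have wr: "adj w r = (b, b)" 
      proof (rule adj_diag_sym)
        have "adj z w = adj r w" using R(10)[of w] T(1,5,6) r(4) by auto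
        then show "adj r w = (b, b)" using adj_diag_sym[OF w(1)] by simp
      qed
      have wy': "adj w y = (\<not> b, \<not> b)" using adj_diag_sym[of y w] w(2) wxy by simp
      let ?S = "{x, y, z, w}"
      have SV: "?S \<subseteq> V" using F(1-3) T(1) by blast
      \<comment> \<open>The labelled pairs \<open>x y\<close>, \<open>x z\<close>,
        \<open>y w\<close> connect \<open>?S\<close>, and their labels \<open>z\<close>,
        \<open>w\<close>, \<open>x\<close> all lie in \<open>?S\<close>.\<close>
      have out: "adj u x = adj u y" "adj u x = adj u z" "adj u x = adj u w"
        if "u \<in> V" "u \<notin> insert r ?S" for u
      proof -
        have "adj x u = adj y u" "adj x u = adj z u" "adj y u = adj w u"
          using that F(10)[of u] T(10)[of u] H0(10)[of u] by auto
        then show "adj u x = adj u y" "adj u x = adj u z" "adj u x = adj u w"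
          using adj_right_iff[of u x y] adj_right_iff[of u x z] adj_right_iff[of u x w] by simp_all
      qed
      have r_S: "adj p r = (b, b)" if "p \<in> ?S" for p
        using that r(2) yr wr R(7) by auto
      \<comment> \<open>Neither a four-vertex path nor its complement has a vertex adjacent to all
        others.\<close>
      have S_not_const: "\<exists>s\<in>?S. \<exists>s'\<in>?S. s \<noteq> p \<and> s' \<noteq> p \<and> adj p s \<noteq> adj p s'" if p: "p \<in> ?S" for p
      proof -
        have d: "x \<noteq> y" "x \<noteq> z" "x \<noteq> w" "y \<noteq> z" "y \<noteq> w" "z \<noteq> w"
          using F(4-6) T(4-6) wy by auto
        have zy: "adj z y = (b, b)" and zx: "adj z x = (\<not> b, \<not> b)" and wx: "adj w x = (\<not> b, \<not> b)"
          using adj_diag_sym[OF yz] T(8) adj_diag_sym[OF w(2)] by auto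
        have yw: "adj y w = (\<not> b, \<not> b)" using adj_diag_sym[OF wy'] .
        consider "p = x" | "p = y" | "p = z" | "p = w" using p by blast
        then show ?thesis
        proof cases
          case 1 then show ?thesis using d F(7) T(7) by (intro bexI[of _ y] bexI[of _ z]) simp_all
        next
          case 2 then show ?thesis using d yz yw by (intro bexI[of _ z] bexI[of _ w]) simp_all
        next
          case 3 then show ?thesis using d zx zy by (intro bexI[of _ x] bexI[of _ y]) simp_all
        next
          case 4 then show ?thesis using d w(1) wx by (intro bexI[of _ x] bexI[of _ z]) simp_all
        qed
      qed
      \<comment> \<open>\<open>q\<close> sees all of \<open>?S\<close> alike, and no vertex of
        \<open>?S\<close> other than \<open>p\<close> separates \<open>p\<close> from
        \<open>q\<close>; so \<open>p\<close> would see the rest of \<open>?S\<close> alike.\<close>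
      have mixed: False if h: "near c r p q" and p: "p \<in> ?S" and q: "q \<notin> ?S" for c p q
      proof -
        note H = nearD[OF h]
        obtain s s' where s: "s \<in> ?S" "s' \<in> ?S" "s \<noteq> p" "s' \<noteq> p" "adj p s \<noteq> adj p s'"
          using S_not_const[OF p] by blast
        have "s \<noteq> r" "s' \<noteq> r" using s(1,2) r(3,4) R(4-6) by auto
        then have "adj p s = adj q s" "adj p s' = adj q s'"
          using H(10)[of s] H(10)[of s'] s(1-4) q SV by blast+
        moreover have "adj q s = adj q s'" using out[of q] s(1,2) H(3,6) q by auto
        ultimately show False using s by simp
      qed
      have "\<not> near c r p q" for c p q
      proof
        assume h: "near c r p q"
        note H = nearD[OF h]
        consider "p \<in> ?S" "q \<in> ?S" | "p \<in> ?S" "q \<notin> ?S" | "p \<notin> ?S" "q \<in> ?S" | "p \<notin> ?S" "q \<notin> ?S"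
          by blast
        then show False
        proof cases
          case 1 then show ?thesis using r_S[of p] r_S[of q] H(9) by simp
        next
          case 2 then show ?thesis using mixed[OF h] by blast
        next
          case 3 then show ?thesis using mixed[OF near_sym[OF h]] by blast
        next
          case 4
          \<comment> \<open>Only \<open>x\<close> separates \<open>z\<close> from \<open>r\<close>,
            so \<open>r\<close> sees \<open>p\<close> and \<open>q\<close> as \<open>z\<close> does,
            and \<open>z\<close> does not separate them.\<close>
          have "adj z p = adj r p" "adj z q = adj r q" using R(10)[of p] R(10)[of q] H(2,3,5,6) 4 by blast+
          moreover have "adj p z = adj q z" using H(10)[of z] 4 R(2,4) by auto
          ultimately show ?thesis using H(9) by (metis adj_right_iff)
        qed
      qed
      then show ?thesis using R(3) by blast
    qed
  qed
qed

text \<open>One label lies in the other pair, as \<open>y\<close>, \<open>z\<close> would otherwise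
  have both types at once. If both labels do, the single-arc module arises; if only one does, the
  path, up to exchanging the types together with the pairs.\<close>

lemma mixed_few_labels:
  assumes f: "near b v x y" and t: "near (\<not> b) w x z"
  shows "\<exists>u\<in>V. \<exists>P. \<forall>c p q. near c u p q \<longrightarrow> {p, q} = P"
proof -
  note F = nearD[OF f] and T = nearD[OF t]
  have "v = z \<or> w = y"
  proof (rule ccontr)
    assume *: "\<not> (v = z \<or> w = y)"
    have "y \<noteq> z" using F T by auto
    then have "adj y z = (\<not> b, \<not> b)" "adj z y = (b, b)"
      using * F(10)[of z] T(10)[of y] F T by auto
    then show False by (metis adj_diag_comm prod.inject)
  qed
  then consider "v = z" "w = y" | "v = z" "w \<noteq> y" | "w = y" "v \<noteq> z" by blast
  then show ?thesis
  proof cases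
    case 1 then have "\<forall>c p q. \<not> near c x p q" using single_arc_triple f t by blast
    then show ?thesis using F(2) by blast
  next
    case 2 then show ?thesis using mixed_path_few_labels[of b z x y w] f t by blast
  next
    case 3 then show ?thesis using mixed_path_few_labels[of "\<not> b" y x z v] f t by simp
  qed
qed

section \<open>Vertices that label few pairs\<close>

lemma few_labels:
  assumes "V \<noteq> {}"
  shows "\<exists>u\<in>V. \<exists>P. \<forall>c p q. near c u p q \<longrightarrow> {p, q} = P"
proof (rule ccontr)
  assume none: "\<not> ?thesis"
  define X where "X b = {x. \<exists>v y. near b v x y}" for b
  define L where "L b = {v. \<exists>x y. near b v x y}" for b
  have XV: "X b \<subseteq> V" and LV: "L b \<subseteq> V" for b
    unfolding X_def L_def using nearD(1,2) by blast+
  have disj: "X True \<inter> X False = {}"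
    using mixed_few_labels[of True] none unfolding X_def by fastforce
  have cover: "V \<subseteq> L True \<union> L False"
  proof
    fix u assume "u \<in> V"
    \<comment> \<open>A vertex labelling nothing would satisfy the claim with any
      \<open>P\<close>.\<close>
    then obtain c p q where "near c u p q" using none by blast
    then show "u \<in> L True \<union> L False" unfolding L_def by (cases c) auto
  qed
  have less: "card (L b) < card (X b)" if "X b \<noteq> {}" for b
    using XV that LV
  proof (rule card_near_labels_less)
    fix v assume "v \<in> L b"
    then obtain x y where "near b v x y" unfolding L_def by blast
    then show "\<exists>x\<in>X b. \<exists>y\<in>X b. near b v x y" using near_sym[of b v x y] unfolding X_def by blast
  qed
  have L0: "L b = {}" if "X b = {}" for b
    using that unfolding L_def X_def by blast
  have le: "card (L b) \<le> card (X b)" for b using less[of b] L0[of b] by (cases "X b = {}") auto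
  obtain b where b: "X b \<noteq> {}" using cover assms L0 by (metis Un_empty subset_empty)
  have fin: "finite (X b)" "finite (L b)" for b using XV LV finite_subset[OF _ finV] by metis+
  \<comment> \<open>Every vertex is a label, so the left side is at least \<open>card V\<close>; by
    disjointness the right side is at most \<open>card V\<close>.\<close>
  have "card (L True) + card (L False) < card (X True) + card (X False)"
    using less[OF b] le[of True] le[of False] by (cases b) auto
  also have "\<dots> = card (X True \<union> X False)"
    using disj fin by (simp add: card_Un_disjoint)
  also have "\<dots> \<le> card V" using XV finV by (intro card_mono) auto
  also have "\<dots> \<le> card (L True \<union> L False)" using cover fin by (intro card_mono) auto
  also have "\<dots> \<le> card (L True) + card (L False)" by (rule card_Un_le)
  finally show False by simp
qed

text \<open>For a single type, Bondy's theorem gives fewer labels than vertices. This serves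
  matrices with constant diagonal.\<close>

lemma ex_not_label:
  assumes "V \<noteq> {}"
  shows "\<exists>v\<in>V. \<forall>x y. \<not> near b v x y"
proof (rule ccontr)
  assume "\<not> ?thesis"
  then have "\<And>v. v \<in> V \<Longrightarrow> \<exists>x\<in>V. \<exists>y\<in>V. near b v x y" using nearD(2,3) by meson
  from card_near_labels_less[OF order_refl assms order_refl this] show False by simp
qed

end

section \<open>From labels to the size of the obstruction\<close>

lemma card_le_parts:
  fixes m :: nat
  assumes "finite A" "A \<subseteq> (\<Union>i<m. W i)"
    and "\<And>i x y. \<lbrakk>i < m; x \<in> W i \<inter> A; y \<in> W i \<inter> A\<rbrakk> \<Longrightarrow> x = y"
  shows "card A \<le> m"
proof -
  define f where "f x = (SOME i. i < m \<and> x \<in> W i)" for x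
  have f: "f x < m" "x \<in> W (f x)" if "x \<in> A" for x
    using someI_ex[of "\<lambda>i. i < m \<and> x \<in> W i"] that assms(2) unfolding f_def by blast+
  have "inj_on f A"
    by (rule inj_onI) (metis IntI assms(3) f)
  moreover have "f ` A \<subseteq> {..<m}" using f by auto
  ultimately show ?thesis using card_inj_on_le[of f A "{..<m}"] by simp
qed

lemma dominates_del_vert:
  "x \<rightarrow>\<^bsub>pre_digraph.del_vert D v\<^esub> y \<longleftrightarrow> x \<noteq> v \<and> y \<noteq> v \<and> x \<rightarrow>\<^bsub>D\<^esub> y"
  by (auto simp: pre_digraph.del_vert_def arcs_ends_def arc_to_ends_def image_iff)

theorem theorem2:
  fixes M :: "nat mat" and D :: "('a,'b) pre_digraph" and k l :: nat
  assumes "square_mat M"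
    and "elements_mat M \<subseteq> {0, 1}"
    and "card {i. i < dim_row M \<and> M $$ (i, i) = 0} = k"
    and "card {i. i < dim_row M \<and> M $$ (i, i) = 1} = l"
    and "minimal_M_obstruction M D"
    and "\<not> (\<exists>u v. false_twins D u v)"
    and "\<not> (\<exists>u v. true_twins D u v)"
  shows "card (verts D) \<le> (k + 1) * (l + 1)"
proof (cases "verts D = {}")
  case True
  then show ?thesis by simp
next
  case False
  interpret digraph D using assms(5) by (simp add: minimal_M_obstruction_def)
  let ?m = "dim_row M"
  have M01: "M $$ (i, j) = 0 \<or> M $$ (i, j) = 1" if "i < ?m" "j < ?m" for i j
  proof -
    have "M $$ (i, j) \<in> elements_mat M"
      using assms(1) that by (intro elements_matI[of M ?m ?m i j]) auto
    then show ?thesis using assms(2) by blast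
  qed
  have "{..<?m} = {i. i < ?m \<and> M $$ (i, i) = 0} \<union> {i. i < ?m \<and> M $$ (i, i) = 1}"
    using M01 by auto
  then have m: "?m = k + l"
    using assms(3,4) card_Un_disjoint[of "{i. i < ?m \<and> M $$ (i, i) = 0}" "{i. i < ?m \<and> M $$ (i, i) = 1}"]
    by (metis (mono_tags, lifting) card_lessThan disjoint_iff finite_Un finite_lessThan mem_Collect_eq zero_neq_one)
  let ?E = "\<lambda>x y. x \<rightarrow>\<^bsub>D\<^esub> y"
  interpret T: twin_free "verts D" ?E
  proof
    fix x y b
    assume *: "x \<in> verts D" "y \<in> verts D" "x \<noteq> y" "?E x y = b" "?E y x = b"
    then have "\<not> twins D x y"
      using assms(6,7) unfolding true_twins_def false_twins_def by (cases b) blast+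
    then show "\<exists>w\<in>verts D. w \<noteq> x \<and> w \<noteq> y \<and> (?E x w, ?E w x) \<noteq> (?E y w, ?E w y)"
      using * unfolding twins_def distinguishes_def by auto
  qed simp
  have part: "\<exists>W. (\<Union>i<?m. W i) = verts D - {v} \<and>
      (\<forall>i<?m. \<forall>x\<in>W i. \<forall>y\<in>W i. x \<noteq> y \<longrightarrow> T.near (M $$ (i, i) = 1) v x y)" if v: "v \<in> verts D" for v
  proof -
    let ?D = "pre_digraph.del_vert D v"
    obtain W where W: "M_partition M ?D W" using assms(5) v unfolding minimal_M_obstruction_def by blast
    have cov: "(\<Union>i<?m. W i) = verts D - {v}"
      using W by (simp add: M_partition_def verts_del_vert)
    have inside: "?E x y = (M $$ (i, i) = 1)" if "i < ?m" "x \<in> W i" "y \<in> W i" "x \<noteq> y" for i x y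
    proof -
      have xy: "x \<noteq> v" "y \<noteq> v" using cov that by blast+
      from M01[OF that(1,1)] show ?thesis
      proof
        assume 0: "M $$ (i, i) = 0"
        then have "independent_set ?D (W i)" using W that(1) unfolding M_partition_def by blast
        then have "\<not> x \<rightarrow>\<^bsub>?D\<^esub> y" using that(2,3) unfolding independent_set_def by blast
        then show ?thesis using 0 xy by (simp add: dominates_del_vert)
      next
        assume 1: "M $$ (i, i) = 1"
        then have "strong_clique ?D (W i)" using W that(1) unfolding M_partition_def by blast
        then have "x \<rightarrow>\<^bsub>?D\<^esub> y" using that(2,3,4) unfolding strong_clique_def by blast
        then show ?thesis using 1 by (simp add: dominates_del_vert)
      qed
    qed
    have across: "?E x y = (M $$ (i, j) = 1)" if "i < ?m" "j < ?m" "i \<noteq> j" "x \<in> W i" "y \<in> W j" for i j x y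
    proof -
      have xy: "x \<noteq> v" "y \<noteq> v" using cov that by blast+
      from M01[OF that(1,2)] show ?thesis
      proof
        assume 0: "M $$ (i, j) = 0"
        then have "completely_nonadjacent ?D (W i) (W j)"
          using W that(1-3) unfolding M_partition_def by blast
        then have "\<not> x \<rightarrow>\<^bsub>?D\<^esub> y" using that(4,5) unfolding completely_nonadjacent_def by blast
        then show ?thesis using 0 xy by (simp add: dominates_del_vert)
      next
        assume 1: "M $$ (i, j) = 1"
        then have "completely_adjacent ?D (W i) (W j)"
          using W that(1-3) unfolding M_partition_def by blast
        then have "x \<rightarrow>\<^bsub>?D\<^esub> y" using that(4,5) unfolding completely_adjacent_def by blast
        then show ?thesis using 1 by (simp add: dominates_del_vert)
      qed
    qed
    have "T.near (M $$ (i, i) = 1) v x y" if i: "i < ?m" "x \<in> W i" "y \<in> W i" "x \<noteq> y" for i x y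
    proof -
      let ?b = "M $$ (i, i) = 1"
      have xy: "x \<in> verts D" "y \<in> verts D" "x \<noteq> v" "y \<noteq> v" using cov i by blast+
      have a: "T.adj x y = (?b, ?b)"
        using inside[OF i] inside[OF i(1,3,2)] i(4) by (simp add: T.adj_def)
      have eq: "T.adj x w = T.adj y w" if "w \<in> verts D" "w \<noteq> x" "w \<noteq> y" "w \<noteq> v" for w
      proof -
        have "w \<in> (\<Union>i<?m. W i)" using that(1,4) unfolding cov by simp
        then obtain j where j: "j < ?m" "w \<in> W j" by blast
        show ?thesis
        proof (cases "i = j")
          case True
          then show ?thesis
            using inside[OF i(1,2), of w] inside[OF i(1) _ i(2), of w]
              inside[OF i(1,3), of w] inside[OF i(1) _ i(3), of w] j that(2,3)
            by (simp add: T.adj_def)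
        next
          case False
          then show ?thesis
            using across[OF i(1) j(1) False i(2) j(2)] across[OF j(1) i(1) _ j(2) i(2)]
              across[OF i(1) j(1) False i(3) j(2)] across[OF j(1) i(1) _ j(2) i(3)]
            by (simp add: T.adj_def)
        qed
      qed
      then have "T.adj x v \<noteq> T.adj y v" using T.twin_freeD[OF xy(1,2) i(4) a] by blast
      then show ?thesis unfolding T.near_def using xy v i(4) a eq by auto
    qed
    then show ?thesis using cov by blast
  qed
  show ?thesis
  proof (cases "k = 0 \<or> l = 0")
    case True
    have "{i. i < ?m \<and> M $$ (i, i) = 0} = {} \<or> {i. i < ?m \<and> M $$ (i, i) = 1} = {}"
    proof -
      have "finite {i. i < ?m \<and> M $$ (i, i) = c}" for c by simp
      then show ?thesis using True assms(3,4) card_0_eq by metis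
    qed
    then have "(\<forall>i<?m. (M $$ (i, i) = 1) = True) \<or> (\<forall>i<?m. (M $$ (i, i) = 1) = False)"
      using M01 by blast
    then obtain b where b: "\<And>i. i < ?m \<Longrightarrow> (M $$ (i, i) = 1) = b" by blast
    \<comment> \<open>Every part of \<open>D - v\<close> then has at most one vertex, so there are
      at most \<open>k + l + 1\<close> vertices, which is the claimed bound when
      \<open>k * l = 0\<close>.\<close>
    obtain v where v: "v \<in> verts D" "\<And>x y. \<not> T.near b v x y"
      using T.ex_not_label[OF False] by blast
    obtain W where W: "(\<Union>i<?m. W i) = verts D - {v}"
      and near: "\<forall>i<?m. \<forall>x\<in>W i. \<forall>y\<in>W i. x \<noteq> y \<longrightarrow> T.near (M $$ (i, i) = 1) v x y"
      using part[OF v(1)] by (elim exE conjE)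
    have "card (verts D - {v}) \<le> ?m"
    proof (rule card_le_parts[where W = W])
      show "x = y" if "i < ?m" "x \<in> W i \<inter> (verts D - {v})" "y \<in> W i \<inter> (verts D - {v})" for i x y
        using near b[OF that(1)] v(2)[of x y] that by auto
    qed (use W in auto)
    then show ?thesis using True m v(1) by auto
  next
    case pos: False
    obtain v P where v: "v \<in> verts D" and P: "\<And>c p q. T.near c v p q \<Longrightarrow> {p, q} = P"
      using T.few_labels[OF False] by blast
    obtain W where W: "(\<Union>i<?m. W i) = verts D - {v}"
      and near: "\<forall>i<?m. \<forall>x\<in>W i. \<forall>y\<in>W i. x \<noteq> y \<longrightarrow> T.near (M $$ (i, i) = 1) v x y"
      using part[OF v(1)] by (elim exE conjE)
    \<comment> \<open>Deleting an end of the only pair that \<open>v\<close> can label leaves at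
      most one vertex per part. If \<open>P\<close> is empty, \<open>a\<close> is arbitrary and may
      lie outside \<open>D\<close>; the estimates below permit this.\<close>
    define a where "a = (SOME a. a \<in> P)"
    have "card (verts D - {v} - {a}) \<le> ?m"
    proof (rule card_le_parts[where W = W])
      fix i x y
      assume i: "i < ?m" and x: "x \<in> W i \<inter> (verts D - {v} - {a})" and y: "y \<in> W i \<inter> (verts D - {v} - {a})"
      show "x = y"
      proof (rule ccontr)
        assume "x \<noteq> y"
        then have "{x, y} = P" using P[OF near[rule_format, OF i]] x y by blast
        then have "a \<in> {x, y}" unfolding a_def by (metis insertI1 someI)
        then show False using x y by blast
      qed
    qed (use W in auto)
    moreover have "card (verts D - {v}) \<le> card (verts D - {v} - {a}) + 1"
      by (auto simp: card_Diff_singleton_if)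
    moreover have "card (verts D) = card (verts D - {v}) + 1"
      using card.remove[OF finite_verts v] by simp
    ultimately have "card (verts D) \<le> k + l + 2" using m by linarith
    \<comment> \<open>The two sides differ by \<open>k * l - 1\<close>.\<close>
    also have "\<dots> \<le> (k + 1) * (l + 1)" using pos by (cases k; cases l) auto
    finally show ?thesis .
  qed
qed

end
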